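(* Let $\Gamma\cup\{\alpha\}$ be a finite set of formulas of classical propositional logic $\mathbf{CPL}$ (formulas built from propositional variables with $\wedge,\vee,\neg$ only), and let $\{p_1,\dots,p_n\}$ be the set of propositional variables occurring in $\Gamma\cup\{\alpha\}$. Then $\Gamma\vdash_{\mathbf{CPL}}\alpha$ if and only if $\Gamma,\circ p_1,\dots,\circ p_n\models_{\mathbf{Six}}\alpha$, where $\circ p=\neg\nabla\neg p\vee\neg\nabla\neg\neg p$.
   Context: An involutive Stone algebra is a De Morgan algebra (bounded distributive lattice with $\neg\neg x=x$, $\neg(x\wedge y)=\neg x\vee\neg y$) with a unary $\nabla$ satisfying $\nabla0=0$, $a\wedge\nabla a=a$, $\nabla(a\wedge b)=\nabla a\wedge\nabla b$, $\neg\nabla a\wedge\nabla a=0$; the class is $\mathbf S$. $Fm$ is the set of formulas over a denumerable set of propositional variables built from binary $\wedge,\vee$, unary $\neg,\nabla$ and constants $\bot,\top$; homomorphisms send $\bot\mapsto0,\top\mapsto1$. The logic $\mathbf{Six}$: for nonempty finite premises, $\alpha_1,\dots,\alpha_n\models_{\mathbf{Six}}\alpha$ iff for every $A\in\mathbf S$, every homomorphism $v:\mathfrak{Fm}\to A$ and every $a\in A$, if $v(\alpha_i)\ge a$ for all $i$ then $v(\alpha)\ge a$. $\vdash_{\mathbf{CPL}}$ is classical (two-valued) consequence. *)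

theory Defs
  imports Main "HOL-Library.Countable_Set" "HOL-Library.Infinite_Typeclass"
begin

datatype fm =
    Var nat
  | Bot
  | Top
  | Neg fm
  | Nab fm
  | Conj fm fm
  | Disj fm fm

datatype cpl_fm =
    CVar nat
  | CNeg cpl_fm
  | CConj cpl_fm cpl_fm
  | CDisj cpl_fm cpl_fm

primrec vars :: "cpl_fm \<Rightarrow> nat set" where
  "vars (CVar n) = {n}"
| "vars (CNeg \<phi>) = vars \<phi>"
| "vars (CConj \<phi> \<psi>) = vars \<phi> \<union> vars \<psi>"
| "vars (CDisj \<phi> \<psi>) = vars \<phi> \<union> vars \<psi>"

primrec emb :: "cpl_fm \<Rightarrow> fm" where
  "emb (CVar n) = Var n"
| "emb (CNeg \<phi>) = Neg (emb \<phi>)"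
| "emb (CConj \<phi> \<psi>) = Conj (emb \<phi>) (emb \<psi>)"
| "emb (CDisj \<phi> \<psi>) = Disj (emb \<phi>) (emb \<psi>)"

definition circ :: "fm \<Rightarrow> fm" where
  "circ \<phi> = Disj (Neg (Nab (Neg \<phi>))) (Neg (Nab (Neg (Neg \<phi>))))"

primrec cpl_eval :: "(nat \<Rightarrow> bool) \<Rightarrow> cpl_fm \<Rightarrow> bool" where
  "cpl_eval e (CVar n) = e n"
| "cpl_eval e (CNeg \<phi>) = (\<not> cpl_eval e \<phi>)"
| "cpl_eval e (CConj \<phi> \<psi>) = (cpl_eval e \<phi> \<and> cpl_eval e \<psi>)"
| "cpl_eval e (CDisj \<phi> \<psi>) = (cpl_eval e \<phi> \<or> cpl_eval e \<psi>)"

definition cpl_entails :: "cpl_fm set \<Rightarrow> cpl_fm \<Rightarrow> bool" where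
  "cpl_entails \<Gamma> \<alpha> \<longleftrightarrow> (\<forall>e. (\<forall>\<gamma>\<in>\<Gamma>. cpl_eval e \<gamma>) \<longrightarrow> cpl_eval e \<alpha>)"

record 'a stone_alg =
  carrier :: "'a set"
  meet :: "'a \<Rightarrow> 'a \<Rightarrow> 'a"
  join :: "'a \<Rightarrow> 'a \<Rightarrow> 'a"
  neg :: "'a \<Rightarrow> 'a"
  nab :: "'a \<Rightarrow> 'a"
  zero :: "'a"
  one :: "'a"

locale bounded_distributive_lattice =
  fixes A :: "'a stone_alg"
  assumes meet_closed: "\<lbrakk>x \<in> carrier A; y \<in> carrier A\<rbrakk> \<Longrightarrow> meet A x y \<in> carrier A"
    and join_closed: "\<lbrakk>x \<in> carrier A; y \<in> carrier A\<rbrakk> \<Longrightarrow> join A x y \<in> carrier A"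
    and zero_closed: "zero A \<in> carrier A"
    and one_closed: "one A \<in> carrier A"
    and meet_assoc: "\<lbrakk>x \<in> carrier A; y \<in> carrier A; z \<in> carrier A\<rbrakk>
      \<Longrightarrow> meet A (meet A x y) z = meet A x (meet A y z)"
    and join_assoc: "\<lbrakk>x \<in> carrier A; y \<in> carrier A; z \<in> carrier A\<rbrakk>
      \<Longrightarrow> join A (join A x y) z = join A x (join A y z)"
    and meet_comm: "\<lbrakk>x \<in> carrier A; y \<in> carrier A\<rbrakk> \<Longrightarrow> meet A x y = meet A y x"
    and join_comm: "\<lbrakk>x \<in> carrier A; y \<in> carrier A\<rbrakk> \<Longrightarrow> join A x y = join A y x"
    and meet_absorb: "\<lbrakk>x \<in> carrier A; y \<in> carrier A\<rbrakk> \<Longrightarrow> meet A x (join A x y) = x"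
    and join_absorb: "\<lbrakk>x \<in> carrier A; y \<in> carrier A\<rbrakk> \<Longrightarrow> join A x (meet A x y) = x"
    and meet_join_distrib: "\<lbrakk>x \<in> carrier A; y \<in> carrier A; z \<in> carrier A\<rbrakk>
      \<Longrightarrow> meet A x (join A y z) = join A (meet A x y) (meet A x z)"
    and meet_zero: "x \<in> carrier A \<Longrightarrow> meet A x (zero A) = zero A"
    and join_one: "x \<in> carrier A \<Longrightarrow> join A x (one A) = one A"

locale de_morgan_algebra = bounded_distributive_lattice A for A :: "'a stone_alg" +
  assumes neg_closed: "x \<in> carrier A \<Longrightarrow> neg A x \<in> carrier A"
    and neg_neg: "x \<in> carrier A \<Longrightarrow> neg A (neg A x) = x"
    and neg_meet: "\<lbrakk>x \<in> carrier A; y \<in> carrier A\<rbrakk>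
      \<Longrightarrow> neg A (meet A x y) = join A (neg A x) (neg A y)"

locale involutive_stone_algebra = de_morgan_algebra A for A :: "'a stone_alg" +
  assumes nab_closed: "x \<in> carrier A \<Longrightarrow> nab A x \<in> carrier A"
    and nab_zero: "nab A (zero A) = zero A"
    and meet_nab: "x \<in> carrier A \<Longrightarrow> meet A x (nab A x) = x"
    and nab_meet: "\<lbrakk>x \<in> carrier A; y \<in> carrier A\<rbrakk>
      \<Longrightarrow> nab A (meet A x y) = meet A (nab A x) (nab A y)"
    and neg_nab_meet_nab: "x \<in> carrier A \<Longrightarrow> meet A (neg A (nab A x)) (nab A x) = zero A"

definition alg_le :: "'a stone_alg \<Rightarrow> 'a \<Rightarrow> 'a \<Rightarrow> bool" where
  "alg_le A x y \<longleftrightarrow> meet A x y = x"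

definition fm_hom :: "'a stone_alg \<Rightarrow> (fm \<Rightarrow> 'a) \<Rightarrow> bool" where
  "fm_hom A v \<longleftrightarrow>
     range v \<subseteq> carrier A \<and>
     v Bot = zero A \<and> v Top = one A \<and>
     (\<forall>\<phi>. v (Neg \<phi>) = neg A (v \<phi>)) \<and>
     (\<forall>\<phi>. v (Nab \<phi>) = nab A (v \<phi>)) \<and>
     (\<forall>\<phi> \<psi>. v (Conj \<phi> \<psi>) = meet A (v \<phi>) (v \<psi>)) \<and>
     (\<forall>\<phi> \<psi>. v (Disj \<phi> \<psi>) = join A (v \<phi>) (v \<psi>))"

text \<open>
  A HOL formula cannot quantify over all types, so the algebras range over all
  carriers (of any size) inside a universe type.  By
  \<open>six_entails_universe\<close> below, any infinite universe gives one and the same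
  relation, and it implies preservation of lower bounds in every involutive Stone
  algebra over any type whatsoever.
  The relation is only meant for finite nonempty \<open>\<Gamma>\<close>.
\<close>

definition six_entails :: "'u itself \<Rightarrow> fm set \<Rightarrow> fm \<Rightarrow> bool" where
  "six_entails (_ :: 'u itself) \<Gamma> \<alpha> \<longleftrightarrow>
     (\<forall>(A :: 'u stone_alg) v a.
        involutive_stone_algebra A \<longrightarrow> fm_hom A v \<longrightarrow> a \<in> carrier A \<longrightarrow>
        (\<forall>\<gamma>\<in>\<Gamma>. alg_le A a (v \<gamma>)) \<longrightarrow> alg_le A a (v \<alpha>))"

instance fm :: countable
  by countable_datatype

primrec fm_eval :: "'a stone_alg \<Rightarrow> (nat \<Rightarrow> 'a) \<Rightarrow> fm \<Rightarrow> 'a" where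
  "fm_eval A e (Var n) = e n"
| "fm_eval A e Bot = zero A"
| "fm_eval A e Top = one A"
| "fm_eval A e (Neg \<phi>) = neg A (fm_eval A e \<phi>)"
| "fm_eval A e (Nab \<phi>) = nab A (fm_eval A e \<phi>)"
| "fm_eval A e (Conj \<phi> \<psi>) = meet A (fm_eval A e \<phi>) (fm_eval A e \<psi>)"
| "fm_eval A e (Disj \<phi> \<psi>) = join A (fm_eval A e \<phi>) (fm_eval A e \<psi>)"

primrec shift :: "fm \<Rightarrow> fm" where
  "shift (Var n) = Var (Suc n)"
| "shift Bot = Bot"
| "shift Top = Top"
| "shift (Neg \<phi>) = Neg (shift \<phi>)"
| "shift (Nab \<phi>) = Nab (shift \<phi>)"
| "shift (Conj \<phi> \<psi>) = Conj (shift \<phi>) (shift \<psi>)"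
| "shift (Disj \<phi> \<psi>) = Disj (shift \<phi>) (shift \<psi>)"

theorem six_entails_universe:
  assumes "six_entails TYPE('u::infinite) \<Gamma> \<alpha>"
  shows "six_entails TYPE('w) \<Gamma> \<alpha>"
  unfolding six_entails_def
proof (intro allI impI)
  fix A :: "'w stone_alg" and v a
  assume A: "involutive_stone_algebra A" and v: "fm_hom A v" and a: "a \<in> carrier A"
    and le: "\<forall>\<gamma>\<in>\<Gamma>. alg_le A a (v \<gamma>)"
  interpret involutive_stone_algebra A by (fact A)
  define e where "e = case_nat a (\<lambda>n. v (Var n))"
  define W where "W = fm_eval A e"
  define C where "C = range W"
  have e: "e n \<in> carrier A" for n
    using a v by (auto simp: e_def fm_hom_def split: nat.split)
  have Wc: "W \<phi> \<in> carrier A" for \<phi>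
    by (induction \<phi>) (auto simp: W_def e zero_closed one_closed neg_closed nab_closed
        meet_closed join_closed)
  have CA: "x \<in> carrier A" if "x \<in> C" for x using that Wc by (auto simp: C_def)
  have vW: "v \<phi> = W (shift \<phi>)" for \<phi>
    using v by (induction \<phi>) (auto simp: W_def e_def fm_hom_def)
  have vC: "v \<phi> \<in> C" for \<phi> by (simp add: vW C_def)
  have aC: "a \<in> C"
    unfolding C_def by (rule range_eqI[of _ _ "Var 0"]) (simp add: W_def e_def)
  have cl: "zero A \<in> C" "one A \<in> C"
    "\<And>x. x \<in> C \<Longrightarrow> neg A x \<in> C" "\<And>x. x \<in> C \<Longrightarrow> nab A x \<in> C"
    "\<And>x y. x \<in> C \<Longrightarrow> y \<in> C \<Longrightarrow> meet A x y \<in> C"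
    "\<And>x y. x \<in> C \<Longrightarrow> y \<in> C \<Longrightarrow> join A x y \<in> C"
    using rangeI[of W Bot] rangeI[of W Top]
    by (auto simp: C_def W_def simp flip: fm_eval.simps(4-7))
  have "countable C" unfolding C_def by simp
  then obtain f :: "'w \<Rightarrow> nat" where f: "inj_on f C" unfolding countable_def by blast
  obtain k :: "nat \<Rightarrow> 'u" where k: "inj k"
    using infinite_countable_subset[OF infinite_UNIV] by blast
  define g where "g = k \<circ> f"
  have g: "inj_on g C"
    unfolding g_def using f k by (meson comp_inj_on inj_on_subset subset_UNIV)
  define h where "h = inv_into C g"
  have hg: "h (g x) = x" if "x \<in> C" for x using that g by (simp add: h_def)
  define B :: "'u stone_alg" where "B = \<lparr> carrier = g ` C,
     meet = (\<lambda>x y. g (meet A (h x) (h y))), join = (\<lambda>x y. g (join A (h x) (h y))),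
     neg = (\<lambda>x. g (neg A (h x))), nab = (\<lambda>x. g (nab A (h x))),
     zero = g (zero A), one = g (one A) \<rparr>"
  have B: "involutive_stone_algebra B"
  proof unfold_locales
    fix x y assume "x \<in> carrier B" "y \<in> carrier B"
    then show "meet B x y = meet B y x" "join B x y = join B y x"
      by (auto simp: B_def hg CA meet_comm join_comm)
  qed (auto simp: B_def hg cl CA meet_assoc join_assoc meet_absorb join_absorb
        meet_join_distrib meet_zero join_one neg_neg neg_meet nab_zero meet_nab nab_meet
        neg_nab_meet_nab)
  have gv: "fm_hom B (g \<circ> v)"
    using v vC by (auto simp: fm_hom_def B_def hg)
  have le_iff: "alg_le B (g x) (g y) \<longleftrightarrow> alg_le A x y" if "x \<in> C" "y \<in> C" for x y
    using that inj_on_eq_iff[OF g] by (auto simp: alg_le_def B_def hg cl)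
  have "g a \<in> carrier B" using aC by (simp add: B_def)
  then have "alg_le B (g a) ((g \<circ> v) \<alpha>)"
    using assms[unfolded six_entails_def, rule_format, OF B gv] le aC vC le_iff by simp
  then show "alg_le A a (v \<alpha>)" using le_iff aC vC by simp
qed

end

(* If a <= v(circ p), then x = v(p) is complemented below a, that is, a <= x join neg x and
   a meet x meet neg x = 0.  Hence it suffices to prove the claim for lower bounds b of a that
   lie below x or below neg x for each of the finitely many variables.  Such a b determines a
   classical valuation e, and for every classical formula either v(phi) or neg v(phi) lies
   above b and has a negation disjoint from b, according to the value of phi under e.  Either e
   satisfies the conclusion, or it falsifies a premise and b = 0.  The converse is evaluation in
   the two-element algebra, where nabla is the identity and all circ p have value 1. *)
theory Submission
  imports Defs
begin

section \<open>The two-element algebra and classical evaluation in it\<close>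

definition two_alg :: "'a \<Rightarrow> 'a \<Rightarrow> 'a stone_alg" where
  "two_alg f t = \<lparr> carrier = {f, t}, meet = (\<lambda>x y. if x = t then y else f),
     join = (\<lambda>x y. if x = t then t else y), neg = (\<lambda>x. if x = t then f else t),
     nab = (\<lambda>x. x), zero = f, one = t \<rparr>"

lemma involutive_stone_two_alg: "f \<noteq> t \<Longrightarrow> involutive_stone_algebra (two_alg f t)"
  by unfold_locales (auto simp: two_alg_def)

lemma fm_hom_two_alg:
  assumes "range e \<subseteq> {f, t}"
  shows "fm_hom (two_alg f t) (fm_eval (two_alg f t) e)"
proof -
  have "fm_eval (two_alg f t) e \<phi> \<in> {f, t}" for \<phi>
    using assms by (induction \<phi>) (auto simp: two_alg_def)
  then show ?thesis by (auto simp: fm_hom_def two_alg_def)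
qed

lemma two_alg_eval_emb:
  "f \<noteq> t \<Longrightarrow> fm_eval (two_alg f t) (\<lambda>n. if e n then t else f) (emb \<phi>) =
    (if cpl_eval e \<phi> then t else f)"
  by (induction \<phi>) (auto simp: two_alg_def)

text \<open>With nabla the identity, \<open>circ\<close> amounts to excluded middle; any
  \<open>e\<close> is allowed because \<open>neg\<close> only takes the values \<open>f\<close> and
  \<open>t\<close>.\<close>

lemma two_alg_eval_circ:
  "f \<noteq> t \<Longrightarrow> fm_eval (two_alg f t) e (circ \<phi>) = t"
  by (simp add: circ_def two_alg_def)

section \<open>Order-theoretic facts about lattices given by equations\<close>

context bounded_distributive_lattice
begin

lemma meet_idem:
  assumes "x \<in> carrier A"
  shows "meet A x x = x"
  using meet_absorb[of x "meet A x x"] join_absorb[of x x] assms meet_closed by simp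

lemma zero_meet: "x \<in> carrier A \<Longrightarrow> meet A (zero A) x = zero A"
  using meet_comm meet_zero zero_closed by metis

lemma join_zero: "x \<in> carrier A \<Longrightarrow> join A x (zero A) = x"
  using join_absorb meet_zero zero_closed by metis

lemma alg_le_refl: "x \<in> carrier A \<Longrightarrow> alg_le A x x"
  by (simp add: alg_le_def meet_idem)

lemma alg_le_trans:
  assumes "alg_le A x y" "alg_le A y z" "x \<in> carrier A" "y \<in> carrier A" "z \<in> carrier A"
  shows "alg_le A x z"
  using assms meet_assoc unfolding alg_le_def by metis

lemma alg_le_zero: "x \<in> carrier A \<Longrightarrow> alg_le A (zero A) x"
  by (simp add: alg_le_def zero_meet)

lemma meet_le1:
  assumes "x \<in> carrier A" "y \<in> carrier A"
  shows "alg_le A (meet A x y) x"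
  using assms meet_assoc meet_comm meet_idem meet_closed unfolding alg_le_def by metis

lemma meet_le2:
  assumes "x \<in> carrier A" "y \<in> carrier A"
  shows "alg_le A (meet A x y) y"
  using assms meet_assoc meet_idem unfolding alg_le_def by metis

lemma meet_greatest:
  assumes "alg_le A z x" "alg_le A z y" "x \<in> carrier A" "y \<in> carrier A" "z \<in> carrier A"
  shows "alg_le A z (meet A x y)"
  using assms meet_assoc unfolding alg_le_def by metis

lemma le_join1:
  assumes "x \<in> carrier A" "y \<in> carrier A"
  shows "alg_le A x (join A x y)"
  using assms meet_absorb unfolding alg_le_def by simp

lemma le_join2:
  assumes "x \<in> carrier A" "y \<in> carrier A"
  shows "alg_le A y (join A x y)"
  using assms le_join1 join_comm by metis

lemma join_least:
  assumes "alg_le A x z" "alg_le A y z" "x \<in> carrier A" "y \<in> carrier A" "z \<in> carrier A"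
  shows "alg_le A (join A x y) z"
proof -
  have "meet A (join A x y) z = meet A z (join A x y)"
    using assms(3-5) by (simp add: meet_comm join_closed)
  also have "\<dots> = join A (meet A z x) (meet A z y)"
    using assms(3-5) by (simp add: meet_join_distrib)
  also have "\<dots> = join A x y"
    using assms by (simp add: alg_le_def meet_comm[of z])
  finally show ?thesis by (simp add: alg_le_def)
qed

lemma meet_le_zero:
  assumes "alg_le A x y" "meet A y z = zero A" "x \<in> carrier A" "y \<in> carrier A" "z \<in> carrier A"
  shows "meet A x z = zero A"
  using assms meet_assoc meet_zero unfolding alg_le_def by metis

end

section \<open>Forcing of classical formulas in De Morgan algebras\<close>

context de_morgan_algebra
begin

lemma neg_join:
  assumes "x \<in> carrier A" "y \<in> carrier A"
  shows "neg A (join A x y) = meet A (neg A x) (neg A y)"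
  using assms neg_meet[of "neg A x" "neg A y"] neg_neg[of "meet A (neg A x) (neg A y)"]
  by (simp add: neg_neg neg_closed meet_closed)

text \<open>From x = x meet y follows neg x = neg x join neg y, which is above neg y.\<close>

lemma neg_antimono:
  assumes "alg_le A x y" "x \<in> carrier A" "y \<in> carrier A"
  shows "alg_le A (neg A y) (neg A x)"
  using assms neg_meet[of x y] le_join2[of "neg A x" "neg A y"]
  by (simp add: alg_le_def neg_closed)

text \<open>In a De Morgan algebra b \<le> x does not make b disjoint from neg x. With the second
  conjunct, only b = 0 can force both x and neg x.\<close>

definition forces :: "'a \<Rightarrow> 'a \<Rightarrow> bool" where
  "forces b x \<longleftrightarrow> alg_le A b x \<and> meet A b (neg A x) = zero A"

text \<open>The negation of the meet is neg x join neg y; distributing b over it leaves 0 join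
  0.\<close>

lemma forces_meet:
  assumes "forces b x" "forces b y" "b \<in> carrier A" "x \<in> carrier A" "y \<in> carrier A"
  shows "forces b (meet A x y)"
  using assms
  by (simp add: forces_def meet_greatest neg_meet meet_join_distrib neg_closed join_zero
      zero_closed)

lemma forces_join1:
  assumes "forces b x" "b \<in> carrier A" "x \<in> carrier A" "y \<in> carrier A"
  shows "forces b (join A x y)"
proof -
  have "meet A b (neg A (join A x y)) = meet A (meet A b (neg A x)) (neg A y)"
    using assms by (simp add: neg_join neg_closed meet_assoc)
  moreover have "alg_le A b (join A x y)"
    using assms alg_le_trans[OF _ le_join1] by (simp add: forces_def join_closed)
  ultimately show ?thesis
    using assms by (simp add: forces_def zero_meet neg_closed)
qed

lemma forces_join2:
  assumes "forces b y" "b \<in> carrier A" "x \<in> carrier A" "y \<in> carrier A"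
  shows "forces b (join A x y)"
  using forces_join1[of b y x] assms join_comm by simp

text \<open>Induction on the formula. A true conjunction or a false disjunction needs both parts
  forced, which is \<open>forces_meet\<close>; in the dual cases De Morgan yields a join and one
  forced part is enough. Negation swaps the two values by \<open>neg_neg\<close>.\<close>

lemma forces_eval:
  assumes v: "fm_hom A v" and b: "b \<in> carrier A"
    and vars: "\<And>p. p \<in> vars \<phi> \<Longrightarrow>
      forces b (if e p then v (Var p) else neg A (v (Var p)))"
  shows "forces b (if cpl_eval e \<phi> then v (emb \<phi>) else neg A (v (emb \<phi>)))"
proof -
  have vc: "v \<psi> \<in> carrier A" for \<psi> using v by (auto simp: fm_hom_def)
  have hom: "v (Neg \<psi>) = neg A (v \<psi>)" "v (Conj \<psi> \<chi>) = meet A (v \<psi>) (v \<chi>)"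
    "v (Disj \<psi> \<chi>) = join A (v \<psi>) (v \<chi>)" for \<psi> \<chi>
    using v by (auto simp: fm_hom_def)
  show ?thesis using vars
  proof (induction \<phi>)
    case (CVar p)
    show ?case using CVar.prems[of p] by (simp split: if_splits)
  next
    case (CNeg \<phi>)
    then show ?case by (auto simp: hom neg_neg vc split: if_splits)
  next
    case (CConj \<phi> \<psi>)
    then show ?case
      by (auto simp: hom neg_meet vc neg_closed b intro: forces_meet forces_join1 forces_join2
          split: if_splits)
  next
    case (CDisj \<phi> \<psi>)
    then show ?case
      by (auto simp: hom neg_join vc neg_closed b intro: forces_meet forces_join1 forces_join2
          split: if_splits)
  qed
qed

text \<open>Each a is the join of its meets with x p and neg (x p), so it suffices to bound both
  halves. The induction leaves a arbitrary since it continues with a half in place of a.\<close>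

lemma le_by_literal_cases:
  assumes "finite P" "a \<in> carrier A" "c \<in> carrier A"
    and "\<And>p. p \<in> P \<Longrightarrow> x p \<in> carrier A"
    and "\<And>p. p \<in> P \<Longrightarrow> alg_le A a (join A (x p) (neg A (x p)))"
    and "\<And>b e. b \<in> carrier A \<Longrightarrow> alg_le A b a \<Longrightarrow>
      (\<And>p. p \<in> P \<Longrightarrow> alg_le A b (if e p then x p else neg A (x p))) \<Longrightarrow> alg_le A b c"
  shows "alg_le A a c"
  using assms
proof (induction P arbitrary: a rule: finite_induct)
  case empty
  then show ?case using alg_le_refl by blast
next
  case (insert p P)
  have xp: "x p \<in> carrier A" "neg A (x p) \<in> carrier A"
    using insert.prems(3) neg_closed by auto
  \<comment> \<open>One half of the split at p; \<open>t\<close> records which literal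
    \<open>l\<close> is.\<close>
  have part: "alg_le A (meet A a l) c" if l: "l = (if t then x p else neg A (x p))" for l t
  proof (rule insert.IH)
    have lc: "l \<in> carrier A" using l xp by simp
    show ac: "meet A a l \<in> carrier A" using insert.prems(1) lc by (rule meet_closed)
    show "alg_le A (meet A a l) (join A (x q) (neg A (x q)))" if "q \<in> P" for q
      using alg_le_trans[OF meet_le1] insert.prems(1,3,4) lc ac that join_closed neg_closed
      by (meson insertI2)
    show "alg_le A b c" if b: "b \<in> carrier A" "alg_le A b (meet A a l)"
      and lits: "\<And>q. q \<in> P \<Longrightarrow> alg_le A b (if e q then x q else neg A (x q))" for b e
    \<comment> \<open>A bound below \<open>meet A a l\<close> also lies below \<open>l\<close>, so
      the valuation takes the value \<open>t\<close> at p.\<close>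
    proof (rule insert.prems(5)[of b "e(p := t)"])
      show "alg_le A b a"
        using alg_le_trans[OF b(2) meet_le1] b insert.prems(1) lc ac by blast
      have "alg_le A b l"
        using alg_le_trans[OF b(2) meet_le2] b insert.prems(1) lc ac by blast
      show "alg_le A b (if (e(p := t)) q then x q else neg A (x q))"
        if "q \<in> insert p P" for q
      proof (cases "q = p")
        case True
        then show ?thesis using \<open>alg_le A b l\<close> l by (simp split: if_splits)
      next
        case False
        then show ?thesis using lits[of q] that by simp
      qed
    qed (rule b(1))
  qed (use insert.prems in auto)
  have "alg_le A (meet A a (x p)) c" "alg_le A (meet A a (neg A (x p))) c"
    using part[of _ True] part[of _ False] by simp_all
  then have "alg_le A (join A (meet A a (x p)) (meet A a (neg A (x p)))) c"
    using insert.prems(1,2) xp by (intro join_least meet_closed)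
  \<comment> \<open>By distributivity this is the join of the two halves.\<close>
  moreover have "meet A a (join A (x p) (neg A (x p))) = a"
    using insert.prems(4)[of p] by (simp add: alg_le_def)
  ultimately show ?case
    using insert.prems(1) xp by (simp add: meet_join_distrib)
qed

end

section \<open>The effect of \<open>circ\<close>, and the classical direction\<close>

context involutive_stone_algebra
begin

lemma neg_nab_le_neg:
  assumes "x \<in> carrier A"
  shows "alg_le A (neg A (nab A x)) (neg A x)"
  using assms meet_nab by (intro neg_antimono nab_closed) (simp_all add: alg_le_def)

lemma meet_neg_nab:
  assumes x: "x \<in> carrier A"
  shows "meet A x (neg A (nab A x)) = zero A"
proof (rule meet_le_zero)
  show "alg_le A x (nab A x)" using x by (simp add: alg_le_def meet_nab)
  show "meet A (nab A x) (neg A (nab A x)) = zero A"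
    using x neg_nab_meet_nab meet_comm nab_closed neg_closed by metis
qed (use x nab_closed neg_closed in auto)

text \<open>The left side is the value of \<open>circ\<close> with the double negation removed.
  Since y \<le> nabla y, its disjuncts lie below x and neg x respectively.\<close>

lemma circ_le_excluded_middle:
  assumes x: "x \<in> carrier A"
  shows "alg_le A (join A (neg A (nab A (neg A x))) (neg A (nab A x))) (join A x (neg A x))"
proof (rule join_least)
  have "alg_le A (neg A (nab A (neg A x))) x"
    using neg_nab_le_neg[of "neg A x"] x by (simp add: neg_neg neg_closed)
  then show "alg_le A (neg A (nab A (neg A x))) (join A x (neg A x))"
    using alg_le_trans[OF _ le_join1] x by (simp add: neg_closed nab_closed join_closed)
  show "alg_le A (neg A (nab A x)) (join A x (neg A x))"
    using alg_le_trans[OF neg_nab_le_neg le_join2] x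
    by (simp add: neg_closed nab_closed join_closed)
qed (use x neg_closed nab_closed join_closed in auto)

text \<open>The first disjunct is disjoint from neg x and the second from x, both by
  \<open>meet_neg_nab\<close>.\<close>

lemma circ_meet_contradiction:
  assumes x: "x \<in> carrier A"
  shows "meet A (meet A x (neg A x)) (join A (neg A (nab A (neg A x))) (neg A (nab A x))) = zero A"
proof -
  have "meet A (meet A x (neg A x)) (neg A (nab A (neg A x))) = zero A"
    using x meet_neg_nab[of "neg A x"] by (intro meet_le_zero[OF meet_le2])
      (auto simp: neg_closed nab_closed meet_closed)
  moreover have "meet A (meet A x (neg A x)) (neg A (nab A x)) = zero A"
    using x meet_neg_nab[of x] by (intro meet_le_zero[OF meet_le1])
      (auto simp: neg_closed nab_closed meet_closed)
  ultimately show ?thesis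
    using x by (simp add: meet_join_distrib neg_closed nab_closed meet_closed join_zero zero_closed)
qed

text \<open>Below \<open>circ\<close>, b is disjoint from x meet neg x. If b also lies below one of
  the two literals, meeting b with the other one already gives 0.\<close>

lemma forces_literal:
  assumes x: "x \<in> carrier A" and b: "b \<in> carrier A"
    and circ: "alg_le A b (join A (neg A (nab A (neg A x))) (neg A (nab A x)))"
    and le: "alg_le A b (if t then x else neg A x)"
  shows "forces b (if t then x else neg A x)"
proof -
  let ?c = "join A (neg A (nab A (neg A x))) (neg A (nab A x))"
  have cl: "neg A x \<in> carrier A" "?c \<in> carrier A" "meet A x (neg A x) \<in> carrier A"
    using x by (simp_all add: neg_closed nab_closed join_closed meet_closed)
  have "meet A b (meet A x (neg A x)) = zero A"
    using meet_le_zero[OF circ] circ_meet_contradiction[OF x] meet_comm cl b by metis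
  then have z: "meet A (meet A b x) (neg A x) = zero A" "meet A (meet A b (neg A x)) x = zero A"
    using b x cl by (simp_all add: meet_assoc meet_comm[of "neg A x" x])
  show ?thesis
    using le z x by (cases t) (simp_all add: forces_def alg_le_def neg_neg)
qed

lemma classical_entailment_below_circ:
  assumes ent: "cpl_entails \<Gamma> \<alpha>" and fin: "finite \<Gamma>"
    and v: "fm_hom A v" and a: "a \<in> carrier A"
    and prem: "\<And>\<gamma>. \<gamma> \<in> \<Gamma> \<Longrightarrow> alg_le A a (v (emb \<gamma>))"
    and circ: "\<And>p. p \<in> (\<Union>\<phi>\<in>insert \<alpha> \<Gamma>. vars \<phi>) \<Longrightarrow> alg_le A a (v (circ (Var p)))"
  shows "alg_le A a (v (emb \<alpha>))"
proof -
  let ?P = "\<Union>\<phi>\<in>insert \<alpha> \<Gamma>. vars \<phi>"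
  let ?c = "\<lambda>x. join A (neg A (nab A (neg A x))) (neg A (nab A x))"
  have vc: "v \<psi> \<in> carrier A" for \<psi> using v by (auto simp: fm_hom_def)
  have vcirc: "v (circ (Var p)) = ?c (v (Var p))" for p
    using v vc by (simp add: fm_hom_def circ_def neg_neg)
  have cc: "?c (v (Var p)) \<in> carrier A" for p
    using vc vcirc by metis
  have "finite (vars \<phi>)" for \<phi> by (induction \<phi>) auto
  then have "finite ?P" using fin by blast
  then show ?thesis
  proof (rule le_by_literal_cases[where x = "\<lambda>p. v (Var p)"])
    fix p assume p: "p \<in> ?P"
    show "alg_le A a (join A (v (Var p)) (neg A (v (Var p))))"
      using alg_le_trans[OF circ[OF p, unfolded vcirc] circ_le_excluded_middle] a vc cc
      by (simp add: join_closed neg_closed)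
  next
    fix b e
    assume b: "b \<in> carrier A" "alg_le A b a"
      and lits: "\<And>p. p \<in> ?P \<Longrightarrow> alg_le A b (if e p then v (Var p) else neg A (v (Var p)))"
    \<comment> \<open>The bound by \<open>circ\<close> passes from a down to b and turns the lower
      bounds \<open>lits\<close> into forcing.\<close>
    have "forces b (if e p then v (Var p) else neg A (v (Var p)))" if "p \<in> ?P" for p
      using forces_literal[OF vc b(1) _ lits[OF that]]
        alg_le_trans[OF b(2) circ[OF that, unfolded vcirc] b(1) a cc] by blast
    \<comment> \<open>\<open>?P\<close> contains the variables of every premise and of the
      conclusion, so a single \<open>e\<close> serves all of them.\<close>
    then have forced: "forces b (if cpl_eval e \<phi> then v (emb \<phi>) else neg A (v (emb \<phi>)))"
      if "\<phi> \<in> insert \<alpha> \<Gamma>" for \<phi>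
      using that by (intro forces_eval[OF v b(1)]) blast
    show "alg_le A b (v (emb \<alpha>))"
    proof (cases "cpl_eval e \<alpha>")
      case True
      then show ?thesis using forced[of \<alpha>] by (simp add: forces_def)
    next
      case False
      \<comment> \<open>By entailment \<open>e\<close> also falsifies some premise. Then b is
        disjoint from the value of that premise and, through a, below it, so b collapses to
        0.\<close>
      then obtain \<gamma> where g: "\<gamma> \<in> \<Gamma>" "\<not> cpl_eval e \<gamma>"
        using ent by (auto simp: cpl_entails_def)
      then have "meet A b (v (emb \<gamma>)) = zero A"
        using forced[of \<gamma>] vc by (simp add: forces_def neg_neg)
      moreover have "alg_le A b (v (emb \<gamma>))"
        using alg_le_trans[OF b(2) prem[OF g(1)]] b(1) a vc by blast
      ultimately have "b = zero A" by (simp add: alg_le_def)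
      then show ?thesis using alg_le_zero vc by simp
    qed
  qed (use a vc in auto)
qed

end

section \<open>Both directions over an infinite universe\<close>

theorem mainTheorem7:
  fixes \<Gamma> :: "cpl_fm set" and \<alpha> :: cpl_fm
  assumes "finite \<Gamma>"
  shows "cpl_entails \<Gamma> \<alpha> \<longleftrightarrow>
    six_entails TYPE('u::infinite)
      (emb ` \<Gamma> \<union> (\<lambda>p. circ (Var p)) ` (\<Union>\<phi>\<in>insert \<alpha> \<Gamma>. vars \<phi>)) (emb \<alpha>)"
    (is "_ \<longleftrightarrow> six_entails _ ?\<Delta> _")
proof
  assume ent: "cpl_entails \<Gamma> \<alpha>"
  show "six_entails TYPE('u) ?\<Delta> (emb \<alpha>)"
    unfolding six_entails_def
  proof (intro allI impI)
    fix A :: "'u stone_alg" and v a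
    assume A: "involutive_stone_algebra A" and v: "fm_hom A v" and a: "a \<in> carrier A"
      and le: "\<forall>\<gamma>\<in>?\<Delta>. alg_le A a (v \<gamma>)"
    show "alg_le A a (v (emb \<alpha>))"
      by (rule involutive_stone_algebra.classical_entailment_below_circ[OF A ent assms v a];
          rule le[rule_format]) simp_all
  qed
next
  assume six: "six_entails TYPE('u) ?\<Delta> (emb \<alpha>)"
  \<comment> \<open>The universe type is arbitrary, so its infinity has to supply the two truth
    values: some element differs from \<open>undefined\<close>.\<close>
  obtain f t :: 'u where ft: "f \<noteq> t"
    using ex_new_if_finite[OF infinite_UNIV, of "{undefined}"] by blast
  show "cpl_entails \<Gamma> \<alpha>"
    unfolding cpl_entails_def
  proof (intro allI impI)
    fix e assume "\<forall>\<gamma>\<in>\<Gamma>. cpl_eval e \<gamma>"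
    let ?v = "fm_eval (two_alg f t) (\<lambda>n. if e n then t else f)"
    have "\<forall>\<gamma>\<in>?\<Delta>. ?v \<gamma> = t"
      using \<open>\<forall>\<gamma>\<in>\<Gamma>. cpl_eval e \<gamma>\<close> by (auto simp: two_alg_eval_emb two_alg_eval_circ ft)
    \<comment> \<open>Here \<open>meet\<close> of \<open>t\<close> and y is y, so the lower bound
      \<open>t\<close> says exactly that a value is \<open>t\<close>.\<close>
    moreover have "alg_le (two_alg f t) t y \<longleftrightarrow> y = t" "t \<in> carrier (two_alg f t)" for y
      by (auto simp: alg_le_def two_alg_def)
    moreover have "fm_hom (two_alg f t) ?v"
      by (rule fm_hom_two_alg) auto
    ultimately have "?v (emb \<alpha>) = t"
      using six[unfolded six_entails_def, rule_format, OF involutive_stone_two_alg[OF ft], of ?v t]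
      by simp
    then show "cpl_eval e \<alpha>" using ft by (simp add: two_alg_eval_emb split: if_splits)
  qed
qed

end
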